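(* Let $F:\mathbb{R}^2\to\mathbb{R}$, $F(x,y)=xy$. For every $\varepsilon>0$, the optimal triangle density for piecewise linear $\varepsilon$-approximations of $F$ is $$\delta^*_{F,\varepsilon}=\frac{3\sqrt3}{32\,\varepsilon}.$$ The optimal triangles (triangles of maximum area admitting a linear $\varepsilon$-approximation of $F$) have area $\frac{32\sqrt3}{9}\,\varepsilon$.
   Context: A triangle is the convex hull of three affinely independent points of $\mathbb{R}^2$. A triangulation of $\mathbb{R}^2$ is a countable family $\mathcal T=\{T_i\}_{i\in I}$ of triangles (index set $I\subseteq\mathbb N$) with $\bigcup_i T_i=\mathbb{R}^2$ such that for distinct $i,j$ the set $T_i\cap T_j$ is empty or a common proper face (vertex or edge) of both, and which is locally finite: for every $R>0$ the set $\{x:\|x\|_\infty\le R\}$ meets only finitely many $T_i$. "Linear" means affine. A function $g:\mathbb{R}^2\to\mathbb{R}$ is piecewise linear (pwl) with respect to $\mathcal T$ if there are affine functions $\ell_i$, $i\in I$, with $g(x)=\ell_{i_x}(x)$ for all $x$, where $i_x=\min\{i\in I: x\in T_i\}$; $g$ need not be continuous. It is a pwl $\varepsilon$-approximation of $F$ if $\sup_{x\in\mathbb{R}^2}|g(x)-F(x)|\le\varepsilon$. The triangle density of $\mathcal T$ is $\delta(\mathcal T)=\limsup_{\ell\to\infty}\frac{|\{T\in\mathcal T: T\cap Q_\ell\neq\emptyset\}|}{\ell^2}$, where $Q_\ell$ is the axis-parallel square of side length $\ell$ centered at the origin. The optimal triangle density $\delta^*_{F,\varepsilon}$ is the infimum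 of $\delta(\mathcal T)$ over all triangulations $\mathcal T$ of $\mathbb{R}^2$ for which there is a pwl $\varepsilon$-approximation of $F$ with respect to $\mathcal T$. A triangle $T$ admits a linear $\varepsilon$-approximation of $F$ if there is an affine $\ell$ with $|\ell(x,y)-F(x,y)|\le\varepsilon$ for all $(x,y)\in T$. *)

theory Defs
  imports "HOL-Analysis.Analysis"
begin

definition triangle :: "(real^2) set \<Rightarrow> bool" where
  "triangle S \<longleftrightarrow> 2 simplex S"

definition affine_function :: "(real^2 \<Rightarrow> real) \<Rightarrow> bool" where
  "affine_function f \<longleftrightarrow> (\<exists>h c. linear h \<and> f = (\<lambda>x. h x + c))"

text \<open>
  The library relation \<open>face_of\<close> admits the improper faces, namely the empty set and the
  whole set; hence the separate clauses. \<open>infnorm\<close> is the maximum norm.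
\<close>
definition triangulation :: "nat set \<Rightarrow> (nat \<Rightarrow> (real^2) set) \<Rightarrow> bool" where
  "triangulation I T \<longleftrightarrow>
     (\<forall>i\<in>I. triangle (T i)) \<and>
     (\<Union>i\<in>I. T i) = UNIV \<and>
     (\<forall>i\<in>I. \<forall>j\<in>I. i \<noteq> j \<longrightarrow>
        T i \<inter> T j = {} \<or>
        (T i \<inter> T j) face_of T i \<and> T i \<inter> T j \<noteq> T i \<and>
        (T i \<inter> T j) face_of T j \<and> T i \<inter> T j \<noteq> T j) \<and>
     (\<forall>R>0. finite {i\<in>I. T i \<inter> {x. infnorm x \<le> R} \<noteq> {}})"

text \<open>On overlaps, the affine piece with the least index counts; no continuity is required.\<close>
definition pwl_wrt :: "nat set \<Rightarrow> (nat \<Rightarrow> (real^2) set) \<Rightarrow> (real^2 \<Rightarrow> real) \<Rightarrow> bool" where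
  "pwl_wrt I T g \<longleftrightarrow>
     (\<exists>l. (\<forall>i\<in>I. affine_function (l i)) \<and>
          (\<forall>x. g x = l (LEAST i. i \<in> I \<and> x \<in> T i) x))"

text \<open>The supremum is taken in the extended reals, so that it is meaningful if unbounded.\<close>
definition pwl_approximation ::
  "nat set \<Rightarrow> (nat \<Rightarrow> (real^2) set) \<Rightarrow> (real^2 \<Rightarrow> real) \<Rightarrow> real \<Rightarrow> (real^2 \<Rightarrow> real) \<Rightarrow> bool" where
  "pwl_approximation I T F \<epsilon> g \<longleftrightarrow>
     pwl_wrt I T g \<and> (SUP x. ereal \<bar>g x - F x\<bar>) \<le> ereal \<epsilon>"

definition centered_square :: "real \<Rightarrow> (real^2) set" where
  "centered_square s = {x. \<bar>x $ 1\<bar> \<le> s / 2 \<and> \<bar>x $ 2\<bar> \<le> s / 2}"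

text \<open>
  The members of a triangulation are pairwise distinct sets, so counting indices is
  counting triangles; by local finiteness the counted sets are finite.
\<close>
definition triangle_density :: "nat set \<Rightarrow> (nat \<Rightarrow> (real^2) set) \<Rightarrow> ereal" where
  "triangle_density I T =
     Limsup at_top (\<lambda>s::real.
       ereal (real (card {i\<in>I. T i \<inter> centered_square s \<noteq> {}}) / s\<^sup>2))"

definition optimal_triangle_density :: "(real^2 \<Rightarrow> real) \<Rightarrow> real \<Rightarrow> ereal" where
  "optimal_triangle_density F \<epsilon> =
     Inf {triangle_density I T | I T.
            triangulation I T \<and> (\<exists>g. pwl_approximation I T F \<epsilon> g)}"

definition admits_linear_approximation ::
  "(real^2 \<Rightarrow> real) \<Rightarrow> real \<Rightarrow> (real^2) set \<Rightarrow> bool" where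
  "admits_linear_approximation F \<epsilon> S \<longleftrightarrow>
     (\<exists>l. affine_function l \<and> (\<forall>x\<in>S. \<bar>l x - F x\<bar> \<le> \<epsilon>))"

definition optimal_triangle :: "(real^2 \<Rightarrow> real) \<Rightarrow> real \<Rightarrow> (real^2) set \<Rightarrow> bool" where
  "optimal_triangle F \<epsilon> S \<longleftrightarrow>
     triangle S \<and> admits_linear_approximation F \<epsilon> S \<and>
     (\<forall>S'. triangle S' \<and> admits_linear_approximation F \<epsilon> S' \<longrightarrow>
        measure lebesgue S' \<le> measure lebesgue S)"

end

theory Submission
  imports Defs
begin

text \<open>
  Write \<open>q(x,y) = xy\<close> and let \<open>d\<^sub>1, d\<^sub>2, d\<^sub>3\<close> be the values of \<open>q\<close> on the edge vectors of a triangle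
  of area \<open>A\<close>. Heron's formula has the indefinite analogue
  \<open>4 A\<^sup>2 = d\<^sub>1\<^sup>2 + d\<^sub>2\<^sup>2 + d\<^sub>3\<^sup>2 - 2 (d\<^sub>1 d\<^sub>2 + d\<^sub>2 d\<^sub>3 + d\<^sub>3 d\<^sub>1)\<close>. If an affine \<open>l\<close> is \<open>\<epsilon>\<close>-close to \<open>q\<close> on the
  triangle and \<open>f\<^sub>i\<close> are the values of \<open>q - l\<close> at the vertices, then looking at the edge from vertex
  \<open>i\<close> to vertex \<open>j\<close> gives
  \<open>- (\<surd>(\<epsilon> - f\<^sub>i) + \<surd>(\<epsilon> - f\<^sub>j))\<^sup>2 \<le> d\<^sub>k \<le> (\<surd>(\<epsilon> + f\<^sub>i) + \<surd>(\<epsilon> + f\<^sub>j))\<^sup>2\<close>. The formula for \<open>4 A\<^sup>2\<close> is convex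
  in each \<open>d\<^sub>k\<close>, so it suffices to bound it at the vertices of this box, where \<open>\<surd>(\<epsilon> \<plusminus> f\<^sub>i)\<close> are the
  cosine and sine of an angle up to a factor. A point reflection or a translation changes \<open>q\<close> only
  by an affine function, so the lattice tiling by copies of one optimal triangle attains the bound.
\<close>

section \<open>The area bound\<close>

text \<open>Sixteen times the squared area of a Euclidean triangle with squared sides \<open>a\<close>, \<open>b\<close>, \<open>c\<close> is \<open>- heron a b c\<close>.\<close>
definition heron :: "real \<Rightarrow> real \<Rightarrow> real \<Rightarrow> real" where
  "heron a b c = a\<^sup>2 + b\<^sup>2 + c\<^sup>2 - 2 * (a * b + b * c + c * a)"

lemma heron_rotate: "heron a b c = heron b c a"
  and heron_minus: "heron (- a) (- b) (- c) = heron a b c"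
  by (simp_all add: heron_def algebra_simps)

text \<open>\<open>y + z\<close>, \<open>x + z\<close>, \<open>x + y\<close> are the sides of a
  possibly degenerate Euclidean triangle with semiperimeter \<open>x + y + z\<close>, so Heron's
  formula factors the value. This serves the box vertices at which all three edge values have the
  same sign.\<close>

lemma heron_squares_nonpos:
  assumes "0 \<le> x" "0 \<le> y" "0 \<le> z"
  shows "heron ((y + z)\<^sup>2) ((x + z)\<^sup>2) ((x + y)\<^sup>2) \<le> 0"
proof -
  have "heron ((y + z)\<^sup>2) ((x + z)\<^sup>2) ((x + y)\<^sup>2) = - (16 * (x + y + z) * (x * y * z))"
    unfolding heron_def by algebra
  moreover have "0 \<le> 16 * (x + y + z) * (x * y * z)"
    using assms by (intro mult_nonneg_nonneg add_nonneg_nonneg) auto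
  ultimately show ?thesis by linarith
qed

lemma square_le_max_endpoints:
  fixes x :: real
  assumes "l \<le> x" "x \<le> u"
  shows "(x - m)\<^sup>2 \<le> max ((l - m)\<^sup>2) ((u - m)\<^sup>2)"
proof (cases "m \<le> x")
  case True
  then have "(x - m)\<^sup>2 \<le> (u - m)\<^sup>2" using assms by (intro power_mono) auto
  then show ?thesis by simp
next
  case False
  then have "(m - x)\<^sup>2 \<le> (m - l)\<^sup>2" using assms by (intro power_mono) auto
  then show ?thesis by (simp add: power2_commute)
qed

text \<open>In its first argument \<open>heron\<close> is a square centred at \<open>b + c\<close>
  plus a constant, hence convex.\<close>

lemma heron_le_max_endpoints:
  assumes "l \<le> x" "x \<le> u"
  shows "heron x b c \<le> max (heron l b c) (heron u b c)"
proof -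
  have *: "heron y b c = (y - (b + c))\<^sup>2 - 4 * b * c" for y
    by (simp add: heron_def power2_eq_square algebra_simps)
  show ?thesis
    using square_le_max_endpoints[OF assms, of "b + c"] unfolding * by (auto simp: max_def split: if_splits)
qed

text \<open>Convexity in each argument separately lets the arguments be moved to interval ends one
  after another; \<open>heron_rotate\<close> brings the one in question to the front.\<close>

lemma heron_le_box:
  assumes "l1 \<le> x" "x \<le> u1" "l2 \<le> y" "y \<le> u2" "l3 \<le> z" "z \<le> u3"
    and vertex: "\<And>a b c. a \<in> {l1, u1} \<Longrightarrow> b \<in> {l2, u2} \<Longrightarrow> c \<in> {l3, u3} \<Longrightarrow> heron a b c \<le> M"
  shows "heron x y z \<le> M"
proof -
  have 1: "heron a b z \<le> M" if "a \<in> {l1, u1}" "b \<in> {l2, u2}" for a b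
    using heron_le_max_endpoints[of l3 z u3 a b] assms vertex[OF that, of l3] vertex[OF that, of u3]
    by (simp add: heron_rotate[of a b] heron_rotate[of b])
  have 2: "heron a y z \<le> M" if "a \<in> {l1, u1}" for a
    using heron_le_max_endpoints[of l2 y u2 z a] assms 1[OF that, of l2] 1[OF that, of u2]
    by (simp add: heron_rotate[of a])
  show ?thesis
    using heron_le_max_endpoints[of l1 x u1 y z] assms 2[of l1] 2[of u1] by simp
qed

text \<open>Monotonicity in \<open>c3\<close> allows \<open>c3 = 1\<close>. With the unit vectors
  written as angles, the value grows with the cosine \<open>x\<close> of half their difference, so
  equal angles are the worst case. What remains is a cubic in \<open>C\<close>, the cosine of half
  their sum.\<close>

lemma heron_mixed_unit:
  assumes "0 \<le> c1" "0 \<le> s1" "c1\<^sup>2 + s1\<^sup>2 = 1"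
    and "0 \<le> c2" "0 \<le> s2" "c2\<^sup>2 + s2\<^sup>2 = 1"
    and "0 \<le> c3" "c3 \<le> 1"
  shows "heron ((c2 + c3)\<^sup>2) ((c1 + c3)\<^sup>2) (- (s1 + s2)\<^sup>2) \<le> 1024 / 27"
proof -
  obtain t1 where t1: "0 \<le> t1" "t1 \<le> pi / 2" "c1 = cos t1" "s1 = sin t1"
    using sincos_total_pi_half assms by blast
  obtain t2 where t2: "0 \<le> t2" "t2 \<le> pi / 2" "c2 = cos t2" "s2 = sin t2"
    using sincos_total_pi_half assms by blast
  define C S x y where "C = cos ((t1 + t2) / 2)" and "S = sin ((t1 + t2) / 2)"
    and "x = cos ((t1 - t2) / 2)" and "y = sin ((t1 - t2) / 2)"
  have e: "t1 = (t1 + t2) / 2 + (t1 - t2) / 2" "t2 = (t1 + t2) / 2 - (t1 - t2) / 2"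
    by (simp_all add: field_simps)
  have c: "c1 = C * x - S * y" "s1 = S * x + C * y" "c2 = C * x + S * y" "s2 = S * x - C * y"
    unfolding t1 t2 C_def S_def x_def y_def
    by (subst e(1) e(2), simp only: cos_add cos_diff sin_add sin_diff)+
  have S2: "S\<^sup>2 = 1 - C\<^sup>2" and y2: "y\<^sup>2 = 1 - x\<^sup>2"
    unfolding C_def S_def x_def y_def by (simp_all add: sin_squared_eq)
  have C: "0 \<le> C" "C \<le> 1" and x: "0 \<le> x" "x \<le> 1"
    unfolding C_def x_def using t1 t2 by (auto intro!: cos_ge_zero)
  \<comment> \<open>In this form every summand is nonnegative and nondecreasing in \<open>c\<close>
    for \<open>c \<ge> 0\<close>.\<close>
  have H: "heron ((c2 + c)\<^sup>2) ((c1 + c)\<^sup>2) (- (s1 + s2)\<^sup>2) =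
      ((c2 - c1)\<^sup>2 * (c1 + c2 + 2 * c)\<^sup>2) + (s1 + s2) ^ 4 + 2 * (s1 + s2)\<^sup>2 * ((c1 + c)\<^sup>2 + (c2 + c)\<^sup>2)" for c
    unfolding heron_def by algebra
  have "heron ((c2 + c3)\<^sup>2) ((c1 + c3)\<^sup>2) (- (s1 + s2)\<^sup>2) \<le>
      heron ((c2 + 1)\<^sup>2) ((c1 + 1)\<^sup>2) (- (s1 + s2)\<^sup>2)"
    unfolding H using assms by (intro add_mono mult_left_mono power_mono) auto
  also have "\<dots> = 16 * S\<^sup>2 * (1 + 2 * C * x + x\<^sup>2)"
    unfolding heron_def c using S2 y2 by algebra
  also have "\<dots> \<le> 16 * S\<^sup>2 * (1 + 2 * C * 1 + 1\<^sup>2)"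
    using C x by (intro mult_left_mono add_mono power_mono) auto
  \<comment> \<open>The cubic \<open>32 * (1 - C) * (1 + C)\<^sup>2\<close> is maximal on the unit
    interval at \<open>C = 1 / 3\<close>, which is therefore a double root of the
    difference.\<close>
  also have "\<dots> = 1024 / 27 - 32 * (C - 1 / 3)\<^sup>2 * (C + 5 / 3)"
    unfolding S2 by (simp add: power2_eq_square field_simps)
  also have "\<dots> \<le> 1024 / 27"
    using C by simp
  finally show ?thesis .
qed

lemma heron_scale: "heron (k * a) (k * b) (k * c) = k\<^sup>2 * heron a b c"
  by (simp add: heron_def power2_eq_square algebra_simps)

text \<open>Dividing all lengths by \<open>sqrt (2 * \<epsilon>)\<close> gives the unit case;
  \<open>heron\<close> is homogeneous of degree two, so the constant becomes
  \<open>(2 * \<epsilon>)\<^sup>2 * 1024 / 27\<close>.\<close>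

lemma heron_mixed:
  assumes "0 < \<epsilon>"
    and "0 \<le> p1" "0 \<le> q1" "p1\<^sup>2 + q1\<^sup>2 = 2 * \<epsilon>"
    and "0 \<le> p2" "0 \<le> q2" "p2\<^sup>2 + q2\<^sup>2 = 2 * \<epsilon>"
    and "0 \<le> p3" "p3\<^sup>2 \<le> 2 * \<epsilon>"
  shows "heron ((p2 + p3)\<^sup>2) ((p1 + p3)\<^sup>2) (- (q1 + q2)\<^sup>2) \<le> 4096 / 27 * \<epsilon>\<^sup>2"
proof -
  define r where "r = sqrt (2 * \<epsilon>)"
  have r: "r > 0" "r\<^sup>2 = 2 * \<epsilon>"
    using assms by (auto simp: r_def)
  have p3: "p3 \<le> r"
    unfolding r_def using assms by (simp add: real_le_rsqrt)
  have "heron ((p2 / r + p3 / r)\<^sup>2) ((p1 / r + p3 / r)\<^sup>2) (- (q1 / r + q2 / r)\<^sup>2) \<le> 1024 / 27"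
    by (rule heron_mixed_unit)
      (use assms r p3 in \<open>auto simp: power_divide simp flip: add_divide_distrib\<close>)
  moreover have "heron ((p2 + p3)\<^sup>2) ((p1 + p3)\<^sup>2) (- (q1 + q2)\<^sup>2) =
      heron (r\<^sup>2 * (p2 / r + p3 / r)\<^sup>2) (r\<^sup>2 * (p1 / r + p3 / r)\<^sup>2) (r\<^sup>2 * - (q1 / r + q2 / r)\<^sup>2)"
    using r(1) by (simp flip: add_divide_distrib add: power_divide)
  ultimately show ?thesis
    unfolding heron_scale r(2)
    using mult_left_mono[of _ "1024 / 27 :: real" "(2 * \<epsilon>)\<^sup>2"]
    by (fastforce simp: power_mult_distrib)
qed

lemma heron_bound:
  assumes "0 < \<epsilon>"
    and f: "\<bar>f1\<bar> \<le> \<epsilon>" "\<bar>f2\<bar> \<le> \<epsilon>" "\<bar>f3\<bar> \<le> \<epsilon>"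
    and d1: "- (sqrt (\<epsilon> - f2) + sqrt (\<epsilon> - f3))\<^sup>2 \<le> d1" "d1 \<le> (sqrt (\<epsilon> + f2) + sqrt (\<epsilon> + f3))\<^sup>2"
    and d2: "- (sqrt (\<epsilon> - f1) + sqrt (\<epsilon> - f3))\<^sup>2 \<le> d2" "d2 \<le> (sqrt (\<epsilon> + f1) + sqrt (\<epsilon> + f3))\<^sup>2"
    and d3: "- (sqrt (\<epsilon> - f1) + sqrt (\<epsilon> - f2))\<^sup>2 \<le> d3" "d3 \<le> (sqrt (\<epsilon> + f1) + sqrt (\<epsilon> + f2))\<^sup>2"
  shows "heron d1 d2 d3 \<le> 4096 / 27 * \<epsilon>\<^sup>2"
proof (rule heron_le_box[OF d1 d2 d3])
  define p1 p2 p3 q1 q2 q3 where "p1 = sqrt (\<epsilon> + f1)" "p2 = sqrt (\<epsilon> + f2)" "p3 = sqrt (\<epsilon> + f3)"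
    and "q1 = sqrt (\<epsilon> - f1)" "q2 = sqrt (\<epsilon> - f2)" "q3 = sqrt (\<epsilon> - f3)"
  note defs = this
  have pos: "0 \<le> p1" "0 \<le> p2" "0 \<le> p3" "0 \<le> q1" "0 \<le> q2" "0 \<le> q3"
    using f unfolding defs by auto
  have s: "p1\<^sup>2 + q1\<^sup>2 = 2 * \<epsilon>" "p2\<^sup>2 + q2\<^sup>2 = 2 * \<epsilon>" "p3\<^sup>2 + q3\<^sup>2 = 2 * \<epsilon>"
    "q1\<^sup>2 + p1\<^sup>2 = 2 * \<epsilon>" "q2\<^sup>2 + p2\<^sup>2 = 2 * \<epsilon>" "q3\<^sup>2 + p3\<^sup>2 = 2 * \<epsilon>"
    using f unfolding defs by (auto simp: abs_le_iff)
  have le: "p1\<^sup>2 \<le> 2 * \<epsilon>" "p2\<^sup>2 \<le> 2 * \<epsilon>" "p3\<^sup>2 \<le> 2 * \<epsilon>" "q1\<^sup>2 \<le> 2 * \<epsilon>" "q2\<^sup>2 \<le> 2 * \<epsilon>" "q3\<^sup>2 \<le> 2 * \<epsilon>"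
    using f unfolding defs by (auto simp: abs_le_iff)
  have M: "0 \<le> 4096 / 27 * \<epsilon>\<^sup>2" by simp
  note mixed = heron_mixed[OF assms(1)]
  \<comment> \<open>The labels tell which arguments are at their upper (U) or lower (L) bound. The
    two pure vertices are Euclidean; the others follow from \<open>mixed\<close> by permuting the
    indices and, when two bounds are lower, by negating all arguments, which exchanges the roles of
    p and q.\<close>
  have UUU: "heron ((p2 + p3)\<^sup>2) ((p1 + p3)\<^sup>2) ((p1 + p2)\<^sup>2) \<le> 4096 / 27 * \<epsilon>\<^sup>2"
    using heron_squares_nonpos[of p1 p2 p3] pos M by linarith
  have LLL: "heron (- (q2 + q3)\<^sup>2) (- (q1 + q3)\<^sup>2) (- (q1 + q2)\<^sup>2) \<le> 4096 / 27 * \<epsilon>\<^sup>2"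
    unfolding heron_minus using heron_squares_nonpos[of q1 q2 q3] pos M by linarith
  have UUL: "heron ((p2 + p3)\<^sup>2) ((p1 + p3)\<^sup>2) (- (q1 + q2)\<^sup>2) \<le> 4096 / 27 * \<epsilon>\<^sup>2"
    using mixed[OF pos(1,4) s(1) pos(2,5) s(2) pos(3) le(3)] .
  have LUU: "heron (- (q2 + q3)\<^sup>2) ((p1 + p3)\<^sup>2) ((p1 + p2)\<^sup>2) \<le> 4096 / 27 * \<epsilon>\<^sup>2"
    using mixed[OF pos(2,5) s(2) pos(3,6) s(3) pos(1) le(1)]
    by (simp add: heron_def algebra_simps)
  have ULU: "heron ((p2 + p3)\<^sup>2) (- (q1 + q3)\<^sup>2) ((p1 + p2)\<^sup>2) \<le> 4096 / 27 * \<epsilon>\<^sup>2"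
    using mixed[OF pos(1,4) s(1) pos(3,6) s(3) pos(2) le(2)]
    by (simp add: heron_def algebra_simps)
  have LLU: "heron (- (q2 + q3)\<^sup>2) (- (q1 + q3)\<^sup>2) ((p1 + p2)\<^sup>2) \<le> 4096 / 27 * \<epsilon>\<^sup>2"
    using mixed[OF pos(4,1) s(4) pos(5,2) s(5) pos(6) le(6)]
    by (simp add: heron_def algebra_simps)
  have ULL: "heron ((p2 + p3)\<^sup>2) (- (q1 + q3)\<^sup>2) (- (q1 + q2)\<^sup>2) \<le> 4096 / 27 * \<epsilon>\<^sup>2"
    using mixed[OF pos(5,2) s(5) pos(6,3) s(6) pos(4) le(4)]
    by (simp add: heron_def algebra_simps)
  have LUL: "heron (- (q2 + q3)\<^sup>2) ((p1 + p3)\<^sup>2) (- (q1 + q2)\<^sup>2) \<le> 4096 / 27 * \<epsilon>\<^sup>2"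
    using mixed[OF pos(4,1) s(4) pos(6,3) s(6) pos(5) le(5)]
    by (simp add: heron_def algebra_simps)
  fix a b c
  assume "a \<in> {- (sqrt (\<epsilon> - f2) + sqrt (\<epsilon> - f3))\<^sup>2, (sqrt (\<epsilon> + f2) + sqrt (\<epsilon> + f3))\<^sup>2}"
    "b \<in> {- (sqrt (\<epsilon> - f1) + sqrt (\<epsilon> - f3))\<^sup>2, (sqrt (\<epsilon> + f1) + sqrt (\<epsilon> + f3))\<^sup>2}"
    "c \<in> {- (sqrt (\<epsilon> - f1) + sqrt (\<epsilon> - f2))\<^sup>2, (sqrt (\<epsilon> + f1) + sqrt (\<epsilon> + f2))\<^sup>2}"
  then show "heron a b c \<le> 4096 / 27 * \<epsilon>\<^sup>2"
    unfolding defs[symmetric] using UUU LLL UUL LUU ULU LLU ULL LUL by blast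
qed

section \<open>Deviation of the saddle from its chords\<close>

text \<open>For interior \<open>t\<close> the chord condition reads
  \<open>d \<le> a / t + b / (1 - t)\<close>. The right side has minimum
  \<open>(sqrt a + sqrt b)\<^sup>2\<close>, at \<open>t = sqrt a / (sqrt a + sqrt b)\<close>. If
  \<open>a\<close> or \<open>b\<close> vanishes, this \<open>t\<close> is not interior and the bound
  arises as a limit.\<close>

lemma second_difference_le:
  fixes a b d :: real
  assumes "0 \<le> a" "0 \<le> b"
    and chord: "\<And>t. 0 \<le> t \<Longrightarrow> t \<le> 1 \<Longrightarrow> t * (1 - t) * d \<le> (1 - t) * a + t * b"
  shows "d \<le> (sqrt a + sqrt b)\<^sup>2"
proof (cases "a = 0 \<or> b = 0")
  case True
  have *: "d \<le> e" if "e \<ge> 0" "\<And>t. 0 < t \<Longrightarrow> t < 1 \<Longrightarrow> (1 - t) * d \<le> e" for e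
  proof (rule ccontr)
    assume "\<not> d \<le> e"
    \<comment> \<open>Here \<open>(1 - t) * d\<close> is the midpoint of \<open>d\<close> and
      \<open>e\<close>, hence larger than \<open>e\<close>.\<close>
    with that(1) that(2)[of "(d - e) / (2 * d)"] show False
      by (auto simp: field_simps)
  qed
  have "d \<le> a + b"
    using True
  proof
    assume a: "a = 0"
    have "(1 - t) * d \<le> b" if "0 < t" "t < 1" for t
      using chord[of t] that a by (simp add: mult.assoc)
    with * assms a show ?thesis by auto
  next
    assume b: "b = 0"
    have "(1 - t) * d \<le> a" if "0 < t" "t < 1" for t
      using chord[of "1 - t"] that b by (simp add: mult.assoc mult.left_commute)
    with * assms b show ?thesis by auto
  qed
  with True assms show ?thesis by auto
next
  case False
  define u v where "u = sqrt a" and "v = sqrt b"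
  have uv: "u > 0" "v > 0" "a = u\<^sup>2" "b = v\<^sup>2"
    using False assms by (auto simp: u_def v_def)
  \<comment> \<open>\<open>k\<close> is the value of \<open>t * (1 - t)\<close> at the optimal
    \<open>t\<close>.\<close>
  define k where "k = u * v / (u + v)\<^sup>2"
  have k: "k > 0" using uv by (simp add: k_def)
  have t: "1 - u / (u + v) = v / (u + v)"
    using uv by (simp add: field_simps)
  have "u / (u + v) * (1 - u / (u + v)) = k"
    unfolding t by (simp add: k_def power2_eq_square)
  moreover have "(1 - u / (u + v)) * a + u / (u + v) * b = (u * v) * (u + v) / (u + v)"
    unfolding t uv by (simp add: add_divide_distrib power2_eq_square algebra_simps)
  moreover have "\<dots> = k * (u + v)\<^sup>2"
    using uv by (simp add: k_def)
  ultimately have "k * d \<le> k * (u + v)\<^sup>2"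
    using chord[of "u / (u + v)"] uv by simp
  then have "d \<le> (u + v)\<^sup>2"
    using k by simp
  then show ?thesis by (simp add: u_def v_def)
qed

definition saddle :: "real^2 \<Rightarrow> real" where
  "saddle v = v $ 1 * v $ 2"

text \<open>A quadratic form deviates from its chord by a multiple of its value on the difference of
  the endpoints; an affine function does not deviate at all.\<close>

lemma saddle_convex_combination:
  assumes "affine_function l"
  shows "saddle ((1 - t) *\<^sub>R a + t *\<^sub>R b) - l ((1 - t) *\<^sub>R a + t *\<^sub>R b) =
    (1 - t) * (saddle a - l a) + t * (saddle b - l b) - t * (1 - t) * saddle (a - b)"
proof -
  obtain h c where "linear h" "l = (\<lambda>x. h x + c)"
    using assms by (auto simp: affine_function_def)
  then have "l ((1 - t) *\<^sub>R a + t *\<^sub>R b) = (1 - t) * l a + t * l b"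
    by (simp add: linear_add linear_scale, simp add: algebra_simps)
  moreover have "saddle ((1 - t) *\<^sub>R a + t *\<^sub>R b) =
      (1 - t) * saddle a + t * saddle b - t * (1 - t) * saddle (a - b)"
    unfolding saddle_def vector_add_component vector_minus_component vector_scaleR_component real_scaleR_def
    by algebra
  ultimately show ?thesis by algebra
qed

text \<open>The two error bounds along the segment are chord conditions: the lower one for
  \<open>saddle (a - b)\<close> and the upper one for its negative.\<close>

lemma saddle_edge_bounds:
  assumes "affine_function l" and approx: "\<And>x. x \<in> closed_segment a b \<Longrightarrow> \<bar>l x - saddle x\<bar> \<le> \<epsilon>"
  shows "- (sqrt (\<epsilon> - (saddle a - l a)) + sqrt (\<epsilon> - (saddle b - l b)))\<^sup>2 \<le> saddle (a - b)"
    and "saddle (a - b) \<le> (sqrt (\<epsilon> + (saddle a - l a)) + sqrt (\<epsilon> + (saddle b - l b)))\<^sup>2"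
proof -
  let ?f = "\<lambda>x. saddle x - l x"
  have f: "\<bar>?f a\<bar> \<le> \<epsilon>" "\<bar>?f b\<bar> \<le> \<epsilon>"
    using approx[of a] approx[of b] by auto
  have chord: "\<bar>(1 - t) * ?f a + t * ?f b - t * (1 - t) * saddle (a - b)\<bar> \<le> \<epsilon>" if "0 \<le> t" "t \<le> 1" for t
  proof -
    have "(1 - t) *\<^sub>R a + t *\<^sub>R b \<in> closed_segment a b"
      using that by (auto simp: closed_segment_def)
    from approx[OF this] show ?thesis
      using saddle_convex_combination[OF assms(1), of t a b] by linarith
  qed
  have "- saddle (a - b) \<le> (sqrt (\<epsilon> - ?f a) + sqrt (\<epsilon> - ?f b))\<^sup>2"
  proof (rule second_difference_le)
    fix t :: real assume "0 \<le> t" "t \<le> 1"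
    from chord[OF this] show "t * (1 - t) * - saddle (a - b) \<le> (1 - t) * (\<epsilon> - ?f a) + t * (\<epsilon> - ?f b)"
      by (auto simp: abs_le_iff algebra_simps)
  qed (use f in auto)
  then show "- (sqrt (\<epsilon> - ?f a) + sqrt (\<epsilon> - ?f b))\<^sup>2 \<le> saddle (a - b)"
    by linarith
  show "saddle (a - b) \<le> (sqrt (\<epsilon> + ?f a) + sqrt (\<epsilon> + ?f b))\<^sup>2"
  proof (rule second_difference_le)
    fix t :: real assume "0 \<le> t" "t \<le> 1"
    from chord[OF this] show "t * (1 - t) * saddle (a - b) \<le> (1 - t) * (\<epsilon> + ?f a) + t * (\<epsilon> + ?f b)"
      by (auto simp: abs_le_iff algebra_simps)
  qed (use f in auto)
qed

section \<open>Triangles and their areas\<close>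

lemma triangleE:
  assumes "triangle S"
  obtains a b c where "S = convex hull {a, b, c}"
proof -
  obtain C where C: "int (card C) = 2 + 1" "S = convex hull C"
    using assms by (auto simp: triangle_def simplex_def)
  then have "card C = 3" by simp
  with C(2) show ?thesis using that by (auto simp: card_3_iff)
qed

lemma triangle_imp_compact: "triangle S \<Longrightarrow> compact S"
  by (erule triangleE) (simp add: finite_imp_compact_convex_hull)

lemma triangle_imp_convex: "triangle S \<Longrightarrow> convex S"
  by (erule triangleE) (simp add: convex_convex_hull)

definition det2 :: "real^2 \<Rightarrow> real^2 \<Rightarrow> real" where
  "det2 p q = p $ 1 * q $ 2 - p $ 2 * q $ 1"

lemma measure_lebesgue_triangle: "measure lebesgue (convex hull {a, b, c}) = \<bar>det2 (b - a) (c - a)\<bar> / 2"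
proof -
  have "closed (convex hull {a, b, c})"
    by (simp add: compact_imp_closed finite_imp_compact_convex_hull)
  then show ?thesis
    by (simp add: content_triangle det2_def abs_minus_commute mult.commute)
qed

lemma measure_triangle_le:
  assumes "\<epsilon> > 0" "triangle S" "admits_linear_approximation saddle \<epsilon> S"
  shows "measure lebesgue S \<le> 32 * sqrt 3 / 9 * \<epsilon>"
proof -
  obtain a b c where S: "S = convex hull {a, b, c}"
    using assms(2) by (rule triangleE)
  obtain l where l: "affine_function l" and approx: "\<And>x. x \<in> S \<Longrightarrow> \<bar>l x - saddle x\<bar> \<le> \<epsilon>"
    using assms(3) by (auto simp: admits_linear_approximation_def)
  have v: "a \<in> S" "b \<in> S" "c \<in> S"
    unfolding S by (auto intro: hull_inc)
  have seg: "\<bar>l x - saddle x\<bar> \<le> \<epsilon>" if "x \<in> closed_segment p q" "p \<in> S" "q \<in> S" for x p q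
  proof -
    have "closed_segment p q \<subseteq> S"
      using that unfolding S by (intro closed_segment_subset) (auto simp: convex_convex_hull)
    with that(1) approx show ?thesis by blast
  qed
  have f: "\<bar>saddle p - l p\<bar> \<le> \<epsilon>" if "p \<in> S" for p
    using approx[OF that] by linarith
  let ?D = "det2 (b - a) (c - a)"
  \<comment> \<open>The indefinite Heron formula: \<open>?D\<close> is twice the signed
    area.\<close>
  have "?D\<^sup>2 = heron (saddle (b - c)) (saddle (a - c)) (saddle (a - b))"
    unfolding heron_def saddle_def det2_def vector_minus_component by algebra
  also have "\<dots> \<le> 4096 / 27 * \<epsilon>\<^sup>2"
    by (rule heron_bound[OF assms(1) f[OF v(1)] f[OF v(2)] f[OF v(3)]])
      (rule saddle_edge_bounds[OF l] seg v | assumption)+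
  also have "\<dots> = (2 * (32 * sqrt 3 / 9 * \<epsilon>))\<^sup>2"
    by (simp add: power_mult_distrib power_divide)
  finally have "\<bar>?D\<bar>\<^sup>2 \<le> (2 * (32 * sqrt 3 / 9 * \<epsilon>))\<^sup>2"
    unfolding power2_abs .
  then have "\<bar>?D\<bar> \<le> 2 * (32 * sqrt 3 / 9 * \<epsilon>)"
    by (rule power2_le_imp_le) (use assms(1) in simp)
  then have "\<bar>?D\<bar> / 2 \<le> 32 * sqrt 3 / 9 * \<epsilon>"
    by linarith
  then show ?thesis
    unfolding S measure_lebesgue_triangle .
qed

section \<open>Density and triangle area\<close>

lemma centered_square_eq_cbox:
  "centered_square s = cbox (vector [- s / 2, - s / 2]) (vector [s / 2, s / 2])"
  by (auto simp: centered_square_def mem_box_cart forall_2 abs_le_iff)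

lemma centered_square_eq_infnorm: "centered_square s = {x. infnorm x \<le> s / 2}"
  by (auto simp: centered_square_def infnorm_2)

lemma measure_centered_square:
  assumes "0 \<le> s"
  shows "measure lebesgue (centered_square s) = s\<^sup>2"
proof -
  have "vector [- s / 2, - s / 2] \<in> cbox (vector [- s / 2, - s / 2] :: real^2) (vector [s / 2, s / 2])"
    using assms by (auto simp: mem_box_cart forall_2)
  then have "cbox (vector [- s / 2, - s / 2] :: real^2) (vector [s / 2, s / 2]) \<noteq> {}"
    by blast
  then show ?thesis
    unfolding centered_square_eq_cbox
    by (simp add: content_cbox_cart UNIV_2 power2_eq_square)
qed

lemma triangulation_finite_meeting:
  assumes "triangulation I T" "0 < s"
  shows "finite {i \<in> I. T i \<inter> centered_square s \<noteq> {}}"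
proof -
  have "0 < s / 2" using assms(2) by simp
  with assms(1) show ?thesis
    unfolding triangulation_def centered_square_eq_infnorm by blast
qed

lemma triangulation_triangle: "triangulation I T \<Longrightarrow> i \<in> I \<Longrightarrow> triangle (T i)"
  by (simp add: triangulation_def)

text \<open>The disjoint case needs no separate treatment: the empty set is a face and differs from
  the nonempty triangle.\<close>

lemma triangulation_Int:
  assumes "triangulation I T" "i \<in> I" "j \<in> I" "i \<noteq> j"
  shows "(T i \<inter> T j) face_of T i" "T i \<inter> T j \<noteq> T i"
proof -
  have "triangle (T i)"
    using assms by (simp add: triangulation_def)
  then have "T i \<noteq> {}"
    by (metis triangleE convex_hull_eq_empty insert_not_empty)
  then show "(T i \<inter> T j) face_of T i" "T i \<inter> T j \<noteq> T i"
    using assms unfolding triangulation_def by (metis empty_face_of)+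
qed

text \<open>A proper face has smaller affine dimension, hence empty interior, and a convex set
  without interior is null.\<close>

lemma negligible_triangulation_Int:
  assumes "triangulation I T" "i \<in> I" "j \<in> I" "i \<noteq> j"
  shows "negligible (T i \<inter> T j)"
proof -
  note T = triangulation_triangle[OF assms(1)]
  have "aff_dim (T i \<inter> T j) < aff_dim (T i)"
    using triangulation_Int[OF assms] triangle_imp_convex[OF T[OF assms(2)]]
    by (intro face_of_aff_dim_lt) auto
  also have "\<dots> \<le> int (DIM(real^2))"
    by (rule aff_dim_le_DIM)
  finally have "interior (T i \<inter> T j) = {}"
    by (intro low_dim_interior) auto
  then show ?thesis
    using T assms by (subst negligible_convex_interior) (auto intro: convex_Int triangle_imp_convex)
qed

text \<open>The triangles meeting the square cover it, so their number times \<open>A\<close> is at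
  least \<open>s\<^sup>2\<close>.\<close>

lemma triangle_density_ge:
  assumes tri: "triangulation I T" and "A > 0" and area: "\<And>i. i \<in> I \<Longrightarrow> measure lebesgue (T i) \<le> A"
  shows "ereal (1 / A) \<le> triangle_density I T"
  unfolding triangle_density_def
proof (rule le_Limsup)
  show "\<forall>\<^sub>F s in at_top. ereal (1 / A) \<le> ereal (card {i \<in> I. T i \<inter> centered_square s \<noteq> {}} / s\<^sup>2)"
    using eventually_gt_at_top[of 0]
  proof eventually_elim
    case (elim s)
    define J where "J = {i \<in> I. T i \<inter> centered_square s \<noteq> {}}"
    have fin: "finite J"
      unfolding J_def using triangulation_finite_meeting[OF tri elim] .
    have lm: "T i \<in> lmeasurable" if "i \<in> J" for i
      using that triangulation_triangle[OF tri] by (auto simp: J_def intro: lmeasurable_compact triangle_imp_compact)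
    have "centered_square s \<subseteq> (\<Union>i\<in>J. T i)"
    proof
      fix x assume x: "x \<in> centered_square s"
      have "x \<in> (\<Union>i\<in>I. T i)" using tri by (simp add: triangulation_def)
      with x show "x \<in> (\<Union>i\<in>J. T i)" by (auto simp: J_def)
    qed
    then have "measure lebesgue (centered_square s) \<le> measure lebesgue (\<Union>i\<in>J. T i)"
      using fin lm by (intro measure_mono_fmeasurable) (auto simp: centered_square_eq_cbox intro: fmeasurable_UN)
    then have "s\<^sup>2 \<le> measure lebesgue (\<Union>i\<in>J. T i)"
      using elim by (simp add: measure_centered_square)
    also have "\<dots> \<le> (\<Sum>i\<in>J. measure lebesgue (T i))"
      using fin lm by (intro measure_UNION_le) auto
    also have "\<dots> \<le> (\<Sum>i\<in>J. A)"
      by (intro sum_mono area) (auto simp: J_def)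
    finally have "s\<^sup>2 \<le> card J * A" by simp
    then have "1 / A \<le> card J / s\<^sup>2"
      using elim \<open>A > 0\<close> by (simp add: field_simps)
    then show ?case by (simp add: J_def)
  qed
qed simp

text \<open>Triangles meeting the square stay within the square of side \<open>s + 2 * d\<close>,
  and their areas add up because overlaps are null. The boundary layer disappears in the
  limit.\<close>

lemma triangle_density_le:
  assumes tri: "triangulation I T" and "A > 0" and area: "\<And>i. i \<in> I \<Longrightarrow> measure lebesgue (T i) = A"
    and "0 \<le> d" and diam: "\<And>i x y. i \<in> I \<Longrightarrow> x \<in> T i \<Longrightarrow> y \<in> T i \<Longrightarrow> infnorm (x - y) \<le> d"
  shows "triangle_density I T \<le> ereal (1 / A)"
proof -
  have "triangle_density I T \<le> Limsup at_top (\<lambda>s. ereal ((1 + 2 * d / s)\<^sup>2 / A))"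
    unfolding triangle_density_def
  proof (rule Limsup_mono)
    show "\<forall>\<^sub>F s in at_top. ereal (card {i \<in> I. T i \<inter> centered_square s \<noteq> {}} / s\<^sup>2) \<le>
        ereal ((1 + 2 * d / s)\<^sup>2 / A)"
      using eventually_gt_at_top[of 0]
    proof eventually_elim
      case (elim s)
      define J where "J = {i \<in> I. T i \<inter> centered_square s \<noteq> {}}"
      have fin: "finite J"
        unfolding J_def using triangulation_finite_meeting[OF tri elim] .
      have lm: "T i \<in> lmeasurable" if "i \<in> J" for i
        using that triangulation_triangle[OF tri] by (auto simp: J_def intro: lmeasurable_compact triangle_imp_compact)
      have "(\<Union>i\<in>J. T i) \<subseteq> centered_square (s + 2 * d)"
      proof clarify
        fix i x assume "i \<in> J" "x \<in> T i"
        then obtain y where "y \<in> T i" "infnorm y \<le> s / 2" and i: "i \<in> I"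
          by (auto simp: J_def centered_square_eq_infnorm)
        with diam[OF i \<open>x \<in> T i\<close>, of y] infnorm_triangle[of "x - y" y]
        show "x \<in> centered_square (s + 2 * d)"
          by (simp add: centered_square_eq_infnorm field_simps)
      qed
      then have "measure lebesgue (\<Union>i\<in>J. T i) \<le> measure lebesgue (centered_square (s + 2 * d))"
        using fin lm by (intro measure_mono_fmeasurable) (auto simp: centered_square_eq_cbox)
      also have "\<dots> = (s + 2 * d)\<^sup>2"
        using elim \<open>0 \<le> d\<close> by (simp add: measure_centered_square)
      finally have "measure lebesgue (\<Union>i\<in>J. T i) \<le> (s + 2 * d)\<^sup>2" .
      moreover have "measure lebesgue (\<Union>i\<in>J. T i) = (\<Sum>i\<in>J. measure lebesgue (T i))"
        using fin lm negligible_triangulation_Int[OF tri]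
        by (intro measure_negligible_finite_Union_image) (auto simp: pairwise_def J_def)
      moreover have "\<dots> = card J * A"
        using area by (simp add: J_def)
      ultimately have "card J * A \<le> (s + 2 * d)\<^sup>2" by simp
      moreover have "(s + 2 * d)\<^sup>2 = s\<^sup>2 * (1 + 2 * d / s)\<^sup>2"
        using elim by (simp add: field_simps flip: power_mult_distrib)
      ultimately have "card J / s\<^sup>2 \<le> (1 + 2 * d / s)\<^sup>2 / A"
        using elim \<open>A > 0\<close> by (simp add: divide_le_eq le_divide_eq mult.commute)
      then show ?case by (simp add: J_def)
    qed
  qed
  also have "((\<lambda>s. (1 + 2 * d / s)\<^sup>2 / A) \<longlongrightarrow> (1 + 0)\<^sup>2 / A) at_top"
    using \<open>A > 0\<close> by (intro tendsto_intros tendsto_divide_0[OF tendsto_const] filterlim_at_top_imp_at_infinity filterlim_ident) auto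
  then have "Limsup at_top (\<lambda>s. ereal ((1 + 2 * d / s)\<^sup>2 / A)) = ereal (1 / A)"
    by (intro lim_imp_Limsup) auto
  finally show ?thesis .
qed

section \<open>From piecewise approximation to single triangles and back\<close>

lemma continuous_on_affine_function: "affine_function l \<Longrightarrow> continuous_on S l"
  unfolding affine_function_def
  by (auto intro!: continuous_on_add continuous_on_const intro: linear_continuous_on
      simp: linear_conv_bounded_linear)

lemma closure_interior_triangle:
  assumes "triangle S"
  shows "closure (interior S) = S"
proof -
  have "aff_dim S = 2"
    using assms by (auto simp: triangle_def intro: aff_dim_simplex)
  then have "interior S = rel_interior S"
    by (simp add: interior_rel_interior)
  then show ?thesis
    using assms by (simp add: convex_closure_rel_interior triangle_imp_convex triangle_imp_compact compact_imp_closed)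
qed

text \<open>On shared boundaries \<open>g\<close> may use the piece of another triangle, so its own
  piece is controlled only in the interior; continuity carries the bound to the closure, which is
  the whole triangle.\<close>

lemma pwl_approximation_imp_admits:
  assumes tri: "triangulation I T" and cont: "continuous_on UNIV F"
    and g: "pwl_approximation I T F \<epsilon> g" and i: "i \<in> I"
  shows "admits_linear_approximation F \<epsilon> (T i)"
proof -
  obtain l where l: "\<And>i. i \<in> I \<Longrightarrow> affine_function (l i)"
    and gl: "\<And>x. g x = l (LEAST i. i \<in> I \<and> x \<in> T i) x"
    using g by (auto simp: pwl_approximation_def pwl_wrt_def)
  have "ereal \<bar>g x - F x\<bar> \<le> ereal \<epsilon>" for x
    using g unfolding pwl_approximation_def by (meson SUP_upper UNIV_I order_trans)
  then have close: "\<bar>g x - F x\<bar> \<le> \<epsilon>" for x by simp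
  have inner: "\<bar>l i x - F x\<bar> \<le> \<epsilon>" if x: "x \<in> interior (T i)" for x
  proof -
    \<comment> \<open>A face other than the whole triangle misses its interior.\<close>
    have "j = i" if "j \<in> I" "x \<in> T j" for j
      using face_of_disjoint_interior[OF triangulation_Int[OF tri i that(1)]] x interior_subset[of "T i"] that
      by auto
    then have "(LEAST i. i \<in> I \<and> x \<in> T i) = i"
      using x interior_subset[of "T i"] i by (intro Least_equality) auto
    then show ?thesis using close[of x] gl[of x] by simp
  qed
  have "\<bar>l i x - F x\<bar> \<le> \<epsilon>" if "x \<in> T i" for x
  proof (rule continuous_le_on_closure[where f = "\<lambda>x. \<bar>l i x - F x\<bar>" and S = "interior (T i)"])
    show "continuous_on (closure (interior (T i))) (\<lambda>x. \<bar>l i x - F x\<bar>)"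
      by (intro continuous_intros continuous_on_affine_function l i continuous_on_subset[OF cont]) auto
  qed (use that inner closure_interior_triangle triangulation_triangle[OF tri i] in auto)
  then show ?thesis
    using l[OF i] by (auto simp: admits_linear_approximation_def)
qed

lemma admits_imp_pwl_approximation:
  assumes tri: "triangulation I T" and adm: "\<And>i. i \<in> I \<Longrightarrow> admits_linear_approximation F \<epsilon> (T i)"
  shows "\<exists>g. pwl_approximation I T F \<epsilon> g"
proof -
  obtain l where l: "\<And>i. i \<in> I \<Longrightarrow> affine_function (l i)"
    and close: "\<And>i x. i \<in> I \<Longrightarrow> x \<in> T i \<Longrightarrow> \<bar>l i x - F x\<bar> \<le> \<epsilon>"
    using adm unfolding admits_linear_approximation_def by metis
  define g where "g x = l (LEAST i. i \<in> I \<and> x \<in> T i) x" for x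
  have "\<bar>g x - F x\<bar> \<le> \<epsilon>" for x
  proof -
    have "x \<in> (\<Union>i\<in>I. T i)"
      using tri by (simp add: triangulation_def)
    then have "\<exists>i. i \<in> I \<and> x \<in> T i" by blast
    from LeastI_ex[OF this] show ?thesis
      unfolding g_def by (intro close) auto
  qed
  then have "pwl_approximation I T F \<epsilon> g"
    using l unfolding pwl_approximation_def pwl_wrt_def g_def by (auto intro!: SUP_least)
  then show ?thesis by blast
qed

section \<open>Lattice triangulations\<close>

text \<open>
  Each triangle of the tiling is an intersection of unit slabs of three linear functions; cutting it
  with another such slab leaves the triangle, one of its faces, or nothing.
\<close>
definition slab :: "(real^2 \<Rightarrow> real) \<Rightarrow> int \<Rightarrow> (real^2) set" where
  "slab f k = {x. of_int k \<le> f x \<and> f x \<le> of_int k + 1}"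

text \<open>Two slabs of \<open>f\<close> with integer offsets coincide, touch in a level set of
  \<open>f\<close>, or are disjoint. A level set at an extreme value of \<open>f\<close> on
  \<open>S\<close> is supporting.\<close>

lemma face_of_Int_slab:
  assumes "convex S" "linear f" "S \<subseteq> slab f k"
  shows "(S \<inter> slab f k') face_of S"
proof -
  \<comment> \<open>Writes \<open>f\<close> as an inner product, the form of supporting
    hyperplanes.\<close>
  have f: "f x = adjoint f 1 \<bullet> x" for x
    using adjoint_works[OF assms(2), of x 1] by (simp add: inner_commute)
  have S: "of_int k \<le> f x" "f x \<le> of_int k + 1" if "x \<in> S" for x
    using assms(3) that by (auto simp: slab_def)
  consider "k' = k" | "k' = k + 1" | "k' = k - 1" | "k' > k + 1 \<or> k' < k - 1"
    by linarith
  then show ?thesis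
  proof cases
    case 1
    then show ?thesis using assms by (simp add: Int_absorb2 face_of_refl)
  next
    case 2
    then have "S \<inter> slab f k' = S \<inter> {x. f x = of_int k + 1}"
      using S by (fastforce simp: slab_def)
    moreover have "(S \<inter> {x. adjoint f 1 \<bullet> x = of_int k + 1}) face_of S"
      using S assms(1) by (intro face_of_Int_supporting_hyperplane_le) (auto simp: f)
    ultimately show ?thesis by (simp add: f)
  next
    case 3
    then have "S \<inter> slab f k' = S \<inter> {x. f x = of_int k}"
      using S by (fastforce simp: slab_def)
    moreover have "(S \<inter> {x. adjoint f 1 \<bullet> x = of_int k}) face_of S"
      using S assms(1) by (intro face_of_Int_supporting_hyperplane_ge) (auto simp: f)
    ultimately show ?thesis by (simp add: f)
  next
    case 4
    have False if x: "x \<in> S" "x \<in> slab f k'" for x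
    proof -
      have "real_of_int k \<le> of_int k' + 1" "real_of_int k' \<le> of_int k + 1"
        using S[OF x(1)] x(2) by (auto simp: slab_def)
      then show False using 4 by linarith
    qed
    then have "S \<inter> slab f k' = {}" by blast
    then show ?thesis by simp
  qed
qed

section \<open>Lattice coordinates and cells\<close>

text \<open>Cramer's rule for the coefficient of \<open>p\<close> in the basis \<open>p\<close>,
  \<open>q\<close>; exchanging the two basis vectors gives the coefficient of
  \<open>q\<close>.\<close>

definition coord :: "real^2 \<Rightarrow> real^2 \<Rightarrow> real^2 \<Rightarrow> real" where
  "coord p q x = det2 x q / det2 p q"

lemma linear_coord: "linear (coord p q)"
  by (rule linearI) (simp_all add: coord_def det2_def add_divide_distrib diff_divide_distrib algebra_simps)

lemma det2_commute: "det2 q p = - det2 p q"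
  by (simp add: det2_def)

lemma coord_expansion:
  assumes "det2 p q \<noteq> 0"
  shows "x = coord p q x *\<^sub>R p + coord q p x *\<^sub>R q"
proof -
  have "det2 p q * (coord p q x * p $ i + coord q p x * q $ i) = det2 p q * x $ i" for i
  proof -
    have "det2 p q * (coord p q x * p $ i + coord q p x * q $ i) = det2 x q * p $ i - det2 x p * q $ i"
      using assms by (simp add: coord_def det2_commute[of q p] field_simps)
    also have "\<dots> = det2 p q * x $ i"
      using exhaust_2[of i] by (auto simp: det2_def algebra_simps)
    finally show ?thesis .
  qed
  then show ?thesis
    using assms by (simp add: vec_eq_iff)
qed

lemma coord_combination:
  assumes "det2 p q \<noteq> 0"
  shows "coord p q (u *\<^sub>R p + v *\<^sub>R q) = u" "coord q p (u *\<^sub>R p + v *\<^sub>R q) = v"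
  using assms by (simp_all add: coord_def det2_def field_simps)

text \<open>
  The fundamental parallelogram of the lattice spanned by \<open>p\<close> and \<open>q\<close> is cut along a diagonal;
  the flag selects the upper half, which is a point reflection of the lower one.
\<close>
definition lattice_cell :: "real^2 \<Rightarrow> real^2 \<Rightarrow> int \<times> int \<times> bool \<Rightarrow> (real^2) set" where
  "lattice_cell p q = (\<lambda>(m, n, b).
     (\<lambda>x. (of_int (m + of_bool b) *\<^sub>R p + of_int (n + of_bool b) *\<^sub>R q) + (if b then - 1 else 1) *\<^sub>R x)
       ` (convex hull {0, p, q}))"

lemma mem_base_triangle_iff:
  assumes "det2 p q \<noteq> 0"
  shows "x \<in> convex hull {0, p, q} \<longleftrightarrow> 0 \<le> coord p q x \<and> 0 \<le> coord q p x \<and> coord p q x + coord q p x \<le> 1"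
proof -
  have "x \<in> convex hull {0, p, q} \<longleftrightarrow>
      (\<exists>u v. x = u *\<^sub>R p + v *\<^sub>R q \<and> 0 \<le> u \<and> 0 \<le> v \<and> u + v \<le> 1)"
    by (auto simp: convex_hull_3_alt)
  then show ?thesis
    using coord_expansion[OF assms, of x] coord_combination[OF assms] by metis
qed

text \<open>Each half is cut out by three of the six slab inequalities, and these imply the other
  three. The slab form is symmetric enough to intersect cells.\<close>

lemma lattice_cell_eq_slabs:
  assumes "det2 p q \<noteq> 0"
  shows "lattice_cell p q (m, n, b) =
    slab (coord p q) m \<inter> slab (coord q p) n \<inter> slab (\<lambda>x. coord p q x + coord q p x) (m + n + of_bool b)"
proof -
  define w where "w = of_int (m + of_bool b) *\<^sub>R p + of_int (n + of_bool b) *\<^sub>R q"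
  define \<sigma> :: real where "\<sigma> = (if b then - 1 else 1)"
  have \<sigma>: "\<sigma> * \<sigma> = 1" by (simp add: \<sigma>_def)
  have w: "coord p q w = of_int (m + of_bool b)" "coord q p w = of_int (n + of_bool b)"
    unfolding w_def by (simp_all only: coord_combination[OF assms])
  have lin: "coord p' q' (\<sigma> *\<^sub>R (x - w)) = \<sigma> * (coord p' q' x - coord p' q' w)" for p' q' x
    by (simp add: linear_scale[OF linear_coord] linear_diff[OF linear_coord])
  have "x \<in> lattice_cell p q (m, n, b) \<longleftrightarrow> \<sigma> *\<^sub>R (x - w) \<in> convex hull {0, p, q}" for x
  proof
    assume "x \<in> lattice_cell p q (m, n, b)"
    then obtain y where "y \<in> convex hull {0, p, q}" "x = w + \<sigma> *\<^sub>R y"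
      unfolding lattice_cell_def w_def \<sigma>_def by auto
    then show "\<sigma> *\<^sub>R (x - w) \<in> convex hull {0, p, q}"
      using \<sigma> by simp
  next
    assume "\<sigma> *\<^sub>R (x - w) \<in> convex hull {0, p, q}"
    moreover have "x = w + \<sigma> *\<^sub>R (\<sigma> *\<^sub>R (x - w))"
      using \<sigma> by simp
    ultimately show "x \<in> lattice_cell p q (m, n, b)"
      unfolding lattice_cell_def w_def[symmetric] \<sigma>_def[symmetric] prod.case by blast
  qed
  then have mem: "x \<in> lattice_cell p q (m, n, b) \<longleftrightarrow>
      0 \<le> \<sigma> * (coord p q x - of_int (m + of_bool b)) \<and> 0 \<le> \<sigma> * (coord q p x - of_int (n + of_bool b)) \<and>
      \<sigma> * (coord p q x - of_int (m + of_bool b)) + \<sigma> * (coord q p x - of_int (n + of_bool b)) \<le> 1" for x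
    unfolding mem_base_triangle_iff[OF assms] lin w .
  show ?thesis
  proof (intro set_eqI)
    fix x
    show "x \<in> lattice_cell p q (m, n, b) \<longleftrightarrow>
      x \<in> slab (coord p q) m \<inter> slab (coord q p) n \<inter> slab (\<lambda>x. coord p q x + coord q p x) (m + n + of_bool b)"
    proof (cases b)
      case True
      then show ?thesis
        unfolding mem slab_def Int_iff mem_Collect_eq \<sigma>_def
        by (simp only: if_True of_bool_eq of_int_add of_int_1) argo
    next
      case False
      then show ?thesis
        unfolding mem slab_def Int_iff mem_Collect_eq \<sigma>_def
        by (simp only: if_False of_bool_eq of_int_add of_int_0) argo
    qed
  qed
qed

text \<open>The condition \<open>\<sigma> * \<sigma> = 1\<close> treats translated and reflected
  copies uniformly in what follows.\<close>

lemma lattice_cell_eq_hull: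
  "\<exists>w \<sigma>. \<sigma> * \<sigma> = 1 \<and> lattice_cell p q i = (\<lambda>x. w + \<sigma> *\<^sub>R x) ` (convex hull {0, p, q}) \<and>
     lattice_cell p q i = convex hull {w, w + \<sigma> *\<^sub>R p, w + \<sigma> *\<^sub>R q}"
proof -
  obtain m n b where i: "i = (m, n, b)" by (cases i)
  define w where "w = of_int (m + of_bool b) *\<^sub>R p + of_int (n + of_bool b) *\<^sub>R q"
  define \<sigma> :: real where "\<sigma> = (if b then - 1 else 1)"
  have "lattice_cell p q i = (\<lambda>x. w + \<sigma> *\<^sub>R x) ` (convex hull {0, p, q})"
    unfolding lattice_cell_def i w_def \<sigma>_def by simp
  moreover have "\<dots> = convex hull {w, w + \<sigma> *\<^sub>R p, w + \<sigma> *\<^sub>R q}"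
    by (simp flip: convex_hull_affinity)
  moreover have "\<sigma> * \<sigma> = 1" by (simp add: \<sigma>_def)
  ultimately show ?thesis by metis
qed

lemma triangle_hull:
  assumes "det2 (b - a) (c - a) \<noteq> 0"
  shows "triangle (convex hull {a, b, c})"
proof -
  have "\<not> collinear {a, b, c}"
  proof
    assume "collinear {a, b, c}"
    then obtain u where "\<forall>x\<in>{a, b, c}. \<forall>y\<in>{a, b, c}. \<exists>k. x - y = k *\<^sub>R u"
      unfolding collinear_def by blast
    then obtain k k' where "b - a = k *\<^sub>R u" "c - a = k' *\<^sub>R u" by blast
    with assms show False by (simp add: det2_def)
  qed
  then have ab: "a \<noteq> b" "a \<noteq> c" "b \<noteq> c" "\<not> affine_dependent {a, b, c}"
    by (auto simp: collinear_3_eq_affine_dependent)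
  then have "int (card {a, b, c}) = 2 + 1" by simp
  with ab show ?thesis
    unfolding triangle_def simplex_def by blast
qed

lemma triangle_lattice_cell:
  assumes "det2 p q \<noteq> 0"
  shows "triangle (lattice_cell p q i)"
proof -
  obtain w \<sigma> where "\<sigma> * \<sigma> = 1" "lattice_cell p q i = convex hull {w, w + \<sigma> *\<^sub>R p, w + \<sigma> *\<^sub>R q}"
    using lattice_cell_eq_hull by metis
  moreover have "det2 (\<sigma> *\<^sub>R p) (\<sigma> *\<^sub>R q) = \<sigma> * \<sigma> * det2 p q"
    by (simp add: det2_def algebra_simps)
  ultimately show ?thesis
    using assms by (simp add: triangle_hull)
qed

lemma measure_lattice_cell: "measure lebesgue (lattice_cell p q i) = \<bar>det2 p q\<bar> / 2"
proof -
  obtain w \<sigma> where \<sigma>: "\<sigma> * \<sigma> = 1" and cell: "lattice_cell p q i = convex hull {w, w + \<sigma> *\<^sub>R p, w + \<sigma> *\<^sub>R q}"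
    using lattice_cell_eq_hull by metis
  have "det2 (\<sigma> *\<^sub>R p) (\<sigma> *\<^sub>R q) = \<sigma> * \<sigma> * det2 p q"
    by (simp add: det2_def algebra_simps)
  then show ?thesis
    unfolding cell measure_lebesgue_triangle by (simp add: \<sigma>)
qed

text \<open>Test on the vertices, whose coordinates are integers: the two ends of the diagonal,
  common to both halves, determine \<open>m'\<close> and \<open>n'\<close>; the third vertex
  determines \<open>b'\<close>.\<close>

lemma lattice_cell_subset_imp_eq:
  assumes pq: "det2 p q \<noteq> 0" and sub: "lattice_cell p q (m, n, b) \<subseteq> lattice_cell p q (m', n', b')"
  shows "(m, n, b) = (m', n', b')"
proof -
  have int: "real_of_int k \<le> of_int x \<and> of_int x \<le> real_of_int k + 1 \<longleftrightarrow> k \<le> x \<and> x \<le> k + 1" for k x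
    by linarith
  have mem: "of_int u *\<^sub>R p + of_int v *\<^sub>R q \<in> lattice_cell p q (k, l, c) \<longleftrightarrow>
      (k \<le> u \<and> u \<le> k + 1) \<and> (l \<le> v \<and> v \<le> l + 1) \<and>
      (k + l + of_bool c \<le> u + v \<and> u + v \<le> k + l + of_bool c + 1)" for u v k l c
    unfolding lattice_cell_eq_slabs[OF pq] slab_def Int_iff mem_Collect_eq coord_combination[OF pq]
      of_int_add[symmetric] int by blast
  have *: "(m' \<le> u \<and> u \<le> m' + 1) \<and> (n' \<le> v \<and> v \<le> n' + 1) \<and>
      (m' + n' + of_bool b' \<le> u + v \<and> u + v \<le> m' + n' + of_bool b' + 1)"
    if "m \<le> u" "u \<le> m + 1" "n \<le> v" "v \<le> n + 1"
      "m + n + of_bool b \<le> u + v" "u + v \<le> m + n + of_bool b + 1" for u v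
    using sub that unfolding mem[symmetric] by (meson mem subsetD)
  have "(m' \<le> m + 1 \<and> m + 1 \<le> m' + 1) \<and> (n' \<le> n \<and> n \<le> n' + 1) \<and>
      (m' + n' + of_bool b' \<le> m + 1 + n \<and> m + 1 + n \<le> m' + n' + of_bool b' + 1)"
    by (rule *) auto
  moreover have "(m' \<le> m \<and> m \<le> m' + 1) \<and> (n' \<le> n + 1 \<and> n + 1 \<le> n' + 1) \<and>
      (m' + n' + of_bool b' \<le> m + (n + 1) \<and> m + (n + 1) \<le> m' + n' + of_bool b' + 1)"
    by (rule *) auto
  ultimately have mn: "m' = m" "n' = n" by linarith+
  have "m' + n' + of_bool b' \<le> m + of_bool b + (n + of_bool b) \<and>
      m + of_bool b + (n + of_bool b) \<le> m' + n' + of_bool b' + 1"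
    using *[of "m + of_bool b" "n + of_bool b"] by (cases b) auto
  then show ?thesis
    unfolding mn by (cases b; cases b') auto
qed

text \<open>Each of the three slabs of the second cell cuts a face out of the first, and an
  intersection of faces is a face.\<close>

lemma lattice_cell_Int:
  assumes pq: "det2 p q \<noteq> 0" and "i \<noteq> j"
  shows "(lattice_cell p q i \<inter> lattice_cell p q j) face_of lattice_cell p q i"
    and "lattice_cell p q i \<inter> lattice_cell p q j \<noteq> lattice_cell p q i"
proof -
  obtain m n b where i: "i = (m, n, b)" by (cases i)
  obtain m' n' b' where j: "j = (m', n', b')" by (cases j)
  let ?S = "lattice_cell p q i"
  have conv: "convex ?S"
    by (rule triangle_imp_convex[OF triangle_lattice_cell[OF pq]])
  have lin: "linear (\<lambda>x. coord p q x + coord q p x)"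
    by (intro linear_compose_add linear_coord)
  have "?S \<inter> lattice_cell p q j =
      (?S \<inter> slab (coord p q) m') \<inter> (?S \<inter> slab (coord q p) n') \<inter>
      (?S \<inter> slab (\<lambda>x. coord p q x + coord q p x) (m' + n' + of_bool b'))"
    unfolding j lattice_cell_eq_slabs[OF pq] by blast
  moreover have "(?S \<inter> slab (coord p q) m') face_of ?S"
    by (rule face_of_Int_slab[OF conv linear_coord, where k = m]) (auto simp: i lattice_cell_eq_slabs[OF pq])
  moreover have "(?S \<inter> slab (coord q p) n') face_of ?S"
    by (rule face_of_Int_slab[OF conv linear_coord, where k = n]) (auto simp: i lattice_cell_eq_slabs[OF pq])
  moreover have "(?S \<inter> slab (\<lambda>x. coord p q x + coord q p x) (m' + n' + of_bool b')) face_of ?S"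
    by (rule face_of_Int_slab[OF conv lin, where k = "m + n + of_bool b"]) (simp add: i lattice_cell_eq_slabs[OF pq])
  ultimately show "(?S \<inter> lattice_cell p q j) face_of ?S"
    by (simp only: face_of_Int)
  show "?S \<inter> lattice_cell p q j \<noteq> ?S"
  proof
    assume "?S \<inter> lattice_cell p q j = ?S"
    then have "?S \<subseteq> lattice_cell p q j" by (simp only: Int_absorb1 le_iff_inf)
    then show False
      using lattice_cell_subset_imp_eq[OF pq] \<open>i \<noteq> j\<close> unfolding i j by blast
  qed
qed

lemma Union_lattice_cell:
  assumes pq: "det2 p q \<noteq> 0"
  shows "(\<Union>i. lattice_cell p q i) = UNIV"
proof (intro set_eqI iffI UNIV_I)
  fix x
  define u v where "u = coord p q x" and "v = coord q p x"
  obtain m :: int where m: "of_int m \<le> u" "u \<le> of_int m + 1"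
    using of_int_floor_le real_of_int_floor_add_one_ge by blast
  obtain n :: int where n: "of_int n \<le> v" "v \<le> of_int n + 1"
    using of_int_floor_le real_of_int_floor_add_one_ge by blast
  \<comment> \<open>\<open>b\<close> tells on which side of the diagonal the point lies; points on
    the diagonal go to the upper half.\<close>
  define b where "b \<longleftrightarrow> of_int m + of_int n + 1 \<le> u + v"
  have "of_int (m + n + of_bool b) \<le> u + v \<and> u + v \<le> of_int (m + n + of_bool b) + 1"
  proof (cases b)
    case True
    then have "of_int m + of_int n + 1 \<le> u + v" by (simp only: b_def)
    with True m n show ?thesis by auto
  next
    case False
    then have "\<not> of_int m + of_int n + 1 \<le> u + v" by (simp only: b_def not_False_eq_True)
    with False m n show ?thesis by auto
  qed
  with m n have "x \<in> lattice_cell p q (m, n, b)"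
    unfolding lattice_cell_eq_slabs[OF pq] slab_def Int_iff mem_Collect_eq u_def[symmetric] v_def[symmetric]
    by blast
  then show "x \<in> (\<Union>i. lattice_cell p q i)" by blast
qed

lemma finite_lattice_cell_meeting:
  assumes pq: "det2 p q \<noteq> 0"
  shows "finite {i. lattice_cell p q i \<inter> {x. infnorm x \<le> R} \<noteq> {}}"
proof -
  obtain B B' where B: "B > 0" "\<And>x. norm (coord p q x) \<le> B * norm x"
    and B': "B' > 0" "\<And>x. norm (coord q p x) \<le> B' * norm x"
    using linear_bounded_pos[OF linear_coord] by metis
  \<comment> \<open>\<open>sqrt 2\<close> compares the Euclidean with the maximum norm,
    \<open>B + B'\<close> serves both coordinates, and the added 1 is the width of a cell.\<close>
  define K where "K = \<lceil>(B + B') * (sqrt 2 * R)\<rceil> + 1"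
  have "{i. lattice_cell p q i \<inter> {x. infnorm x \<le> R} \<noteq> {}} \<subseteq> {- K..K} \<times> {- K..K} \<times> UNIV"
  proof clarsimp
    fix m n b
    assume "lattice_cell p q (m, n, b) \<inter> {x. infnorm x \<le> R} \<noteq> {}"
    then obtain x where x: "x \<in> lattice_cell p q (m, n, b)" and "infnorm x \<le> R" by blast
    then have nx: "norm x \<le> sqrt 2 * R"
      using norm_le_infnorm[of x] by (auto intro: order_trans)
    have "B * norm x \<le> (B + B') * (sqrt 2 * R)" "B' * norm x \<le> (B + B') * (sqrt 2 * R)"
      using B(1) B'(1) nx by (auto intro!: mult_mono)
    then have "\<bar>coord p q x\<bar> \<le> of_int (K - 1)" "\<bar>coord q p x\<bar> \<le> of_int (K - 1)"
      using B(2)[of x] B'(2)[of x] le_of_int_ceiling[of "(B + B') * (sqrt 2 * R)"]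
      unfolding K_def real_norm_def by linarith+
    moreover have "of_int m \<le> coord p q x" "coord p q x \<le> of_int m + 1"
      "of_int n \<le> coord q p x" "coord q p x \<le> of_int n + 1"
      using x by (auto simp: lattice_cell_eq_slabs[OF pq] slab_def)
    ultimately show "- K \<le> m \<and> m \<le> K \<and> - K \<le> n \<and> n \<le> K"
      by linarith
  qed
  then show ?thesis
    by (rule finite_subset) auto
qed

text \<open>Only codes of triples are indices; elsewhere \<open>from_nat\<close> is unspecified and
  cells could repeat.\<close>

definition lattice_index :: "nat set" where
  "lattice_index = range (to_nat :: int \<times> int \<times> bool \<Rightarrow> nat)"

definition lattice_triangulation :: "real^2 \<Rightarrow> real^2 \<Rightarrow> nat \<Rightarrow> (real^2) set" where
  "lattice_triangulation p q k = lattice_cell p q (from_nat k)"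

lemma triangulation_lattice:
  assumes pq: "det2 p q \<noteq> 0"
  shows "triangulation lattice_index (lattice_triangulation p q)"
  unfolding triangulation_def
proof (intro conjI ballI allI impI)
  show "triangle (lattice_triangulation p q i)" for i
    by (simp add: lattice_triangulation_def triangle_lattice_cell[OF pq])
  show "(\<Union>i\<in>lattice_index. lattice_triangulation p q i) = UNIV"
    using Union_lattice_cell[OF pq] by (simp add: lattice_triangulation_def lattice_index_def)
next
  fix R :: real
  have "{i \<in> lattice_index. lattice_triangulation p q i \<inter> {x. infnorm x \<le> R} \<noteq> {}} \<subseteq>
      to_nat ` {i. lattice_cell p q i \<inter> {x. infnorm x \<le> R} \<noteq> {}}"
    unfolding lattice_triangulation_def lattice_index_def by force
  then show "finite {i \<in> lattice_index. lattice_triangulation p q i \<inter> {x. infnorm x \<le> R} \<noteq> {}}"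
    using finite_lattice_cell_meeting[OF pq] by (meson finite_imageI finite_subset)
next
  fix i j assume "i \<in> lattice_index" "j \<in> lattice_index" "i \<noteq> j"
  then obtain i' j' :: "int \<times> int \<times> bool" where *: "i = to_nat i'" "j = to_nat j'" "i' \<noteq> j'"
    by (auto simp: lattice_index_def)
  show "lattice_triangulation p q i \<inter> lattice_triangulation p q j = {} \<or>
     (lattice_triangulation p q i \<inter> lattice_triangulation p q j) face_of lattice_triangulation p q i \<and>
     lattice_triangulation p q i \<inter> lattice_triangulation p q j \<noteq> lattice_triangulation p q i \<and>
     (lattice_triangulation p q i \<inter> lattice_triangulation p q j) face_of lattice_triangulation p q j \<and>
     lattice_triangulation p q i \<inter> lattice_triangulation p q j \<noteq> lattice_triangulation p q j"
    using lattice_cell_Int[OF pq *(3)] lattice_cell_Int[OF pq *(3)[symmetric]]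
    by (simp add: lattice_triangulation_def * Int_commute)
qed

section \<open>Approximation and density on the lattice\<close>

lemma admits_saddle_affinity:
  assumes "\<sigma> * \<sigma> = 1" "admits_linear_approximation saddle \<epsilon> S"
  shows "admits_linear_approximation saddle \<epsilon> ((\<lambda>x. w + \<sigma> *\<^sub>R x) ` S)"
proof -
  obtain h c where h: "linear h" and approx: "\<And>x. x \<in> S \<Longrightarrow> \<bar>h x + c - saddle x\<bar> \<le> \<epsilon>"
    using assms(2) by (auto simp: admits_linear_approximation_def affine_function_def)
  \<comment> \<open>The added term is the bilinear form of the saddle with \<open>w\<close> fixed,
    coming from the expansion of \<open>saddle (y - w)\<close>, which equals \<open>saddle x\<close>
    for \<open>y = w + \<sigma> *\<^sub>R x\<close>.\<close>
  define h' where "h' y = \<sigma> * h y + (w $ 1 * y $ 2 + w $ 2 * y $ 1)" for y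
  have "linear h'"
    unfolding h'_def by (rule linearI) (simp_all add: linear_add[OF h] linear_scale[OF h] algebra_simps)
  then have "affine_function (\<lambda>y. h' y + (c - \<sigma> * h w - saddle w))"
    unfolding affine_function_def by blast
  moreover have "\<bar>h' y + (c - \<sigma> * h w - saddle w) - saddle y\<bar> \<le> \<epsilon>"
    if y: "y \<in> (\<lambda>x. w + \<sigma> *\<^sub>R x) ` S" for y
  proof -
    obtain x where x: "x \<in> S" "y = w + \<sigma> *\<^sub>R x" using y by blast
    have "\<sigma> * h y - \<sigma> * h w = (\<sigma> * \<sigma>) * h x"
      by (simp add: x linear_add[OF h] linear_scale[OF h] algebra_simps)
    moreover have "saddle y = (w $ 1 * y $ 2 + w $ 2 * y $ 1) - saddle w + (\<sigma> * \<sigma>) * saddle x"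
      by (simp add: x saddle_def algebra_simps)
    ultimately have "h' y + (c - \<sigma> * h w - saddle w) - saddle y = h x + c - saddle x"
      using assms(1) by (simp add: h'_def)
    then show ?thesis using approx[OF x(1)] by simp
  qed
  ultimately show ?thesis
    unfolding admits_linear_approximation_def by blast
qed

lemma lattice_pwl_approximation:
  assumes "det2 p q \<noteq> 0" "admits_linear_approximation saddle \<epsilon> (convex hull {0, p, q})"
  shows "\<exists>g. pwl_approximation lattice_index (lattice_triangulation p q) saddle \<epsilon> g"
proof (rule admits_imp_pwl_approximation[OF triangulation_lattice[OF assms(1)]])
  fix i
  obtain w \<sigma> where "\<sigma> * \<sigma> = 1"
    "lattice_triangulation p q i = (\<lambda>x. w + \<sigma> *\<^sub>R x) ` (convex hull {0, p, q})"
    unfolding lattice_triangulation_def using lattice_cell_eq_hull by metis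
  then show "admits_linear_approximation saddle \<epsilon> (lattice_triangulation p q i)"
    using admits_saddle_affinity assms(2) by simp
qed

text \<open>All cells are congruent to the base triangle, so they share its area and one diameter
  bound.\<close>

lemma lattice_density_le:
  assumes "det2 p q \<noteq> 0"
  shows "triangle_density lattice_index (lattice_triangulation p q) \<le> ereal (1 / (\<bar>det2 p q\<bar> / 2))"
proof -
  have "bounded (convex hull {0, p, q})"
    by (simp add: finite_imp_bounded_convex_hull)
  then obtain d where d: "\<And>x. x \<in> convex hull {0, p, q} \<Longrightarrow> norm x \<le> d"
    by (auto simp: bounded_iff)
  have "0 \<le> d"
    using d[of 0] by (simp add: hull_inc)
  show ?thesis
  proof (rule triangle_density_le[OF triangulation_lattice[OF assms]])
    fix i x y assume xy: "x \<in> lattice_triangulation p q i" "y \<in> lattice_triangulation p q i"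
    obtain w \<sigma> where \<sigma>: "\<sigma> * \<sigma> = 1"
      and cell: "lattice_triangulation p q i = (\<lambda>x. w + \<sigma> *\<^sub>R x) ` (convex hull {0, p, q})"
      unfolding lattice_triangulation_def using lattice_cell_eq_hull by metis
    obtain x' y' where x': "x' \<in> convex hull {0, p, q}" "x = w + \<sigma> *\<^sub>R x'"
      and y': "y' \<in> convex hull {0, p, q}" "y = w + \<sigma> *\<^sub>R y'"
      using xy unfolding cell by blast
    have "\<bar>\<sigma>\<bar> = 1"
      using \<sigma> by (metis abs_mult_self_eq abs_1 abs_square_eq_1 power2_eq_square)
    have "infnorm (x - y) \<le> norm (\<sigma> *\<^sub>R (x' - y'))"
      using infnorm_le_norm[of "\<sigma> *\<^sub>R (x' - y')"] by (simp add: x' y' scaleR_diff_right)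
    also have "\<dots> \<le> norm x' + norm y'"
      using \<open>\<bar>\<sigma>\<bar> = 1\<close> norm_triangle_ineq4 by simp
    also have "\<dots> \<le> 2 * d"
      using d[OF x'(1)] d[OF y'(1)] by simp
    finally show "infnorm (x - y) \<le> 2 * d" .
  qed (use assms \<open>0 \<le> d\<close> in \<open>auto simp: lattice_triangulation_def measure_lattice_cell\<close>)
qed

section \<open>The optimal triangle\<close>

text \<open>
  Equality in \<open>heron_mixed_unit\<close> forces \<open>f\<^sub>3 = \<epsilon>\<close> and \<open>f\<^sub>1 = f\<^sub>2 = - 7/9 \<epsilon>\<close>, hence the values
  \<open>32/9 \<epsilon>\<close>, \<open>32/9 \<epsilon>\<close>, \<open>- 64/9 \<epsilon>\<close> of the form on the edges; up to symmetry the vertices are then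
  \<open>0\<close> and the following two points.
\<close>
definition optimal_p :: "real \<Rightarrow> real^2" where
  "optimal_p \<epsilon> = (4 / 3 * sqrt \<epsilon>) *\<^sub>R vector [sqrt 3 + 1, sqrt 3 - 1]"

definition optimal_q :: "real \<Rightarrow> real^2" where
  "optimal_q \<epsilon> = (4 / 3 * sqrt \<epsilon>) *\<^sub>R vector [sqrt 3 - 1, sqrt 3 + 1]"

lemma optimal_nth:
  "optimal_p \<epsilon> $ 1 = 4 / 3 * sqrt \<epsilon> * (sqrt 3 + 1)" "optimal_p \<epsilon> $ 2 = 4 / 3 * sqrt \<epsilon> * (sqrt 3 - 1)"
  "optimal_q \<epsilon> $ 1 = 4 / 3 * sqrt \<epsilon> * (sqrt 3 - 1)" "optimal_q \<epsilon> $ 2 = 4 / 3 * sqrt \<epsilon> * (sqrt 3 + 1)"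
  by (simp_all add: optimal_p_def optimal_q_def)

lemma det2_optimal:
  assumes "0 < \<epsilon>"
  shows "det2 (optimal_p \<epsilon>) (optimal_q \<epsilon>) = 64 * sqrt 3 / 9 * \<epsilon>"
proof -
  define a r where "a = sqrt 3" and "r = sqrt \<epsilon>"
  have "det2 (optimal_p \<epsilon>) (optimal_q \<epsilon>) = 16 / 9 * r\<^sup>2 * ((a + 1)\<^sup>2 - (a - 1)\<^sup>2)"
    unfolding det2_def optimal_nth a_def[symmetric] r_def[symmetric] by algebra
  also have "(a + 1)\<^sup>2 - (a - 1)\<^sup>2 = 4 * a"
    by (simp add: power2_eq_square algebra_simps)
  finally show ?thesis
    using assms by (simp add: a_def r_def)
qed

lemma optimal_admits:
  assumes eps: "0 < \<epsilon>"
  shows "admits_linear_approximation saddle \<epsilon> (convex hull {0, optimal_p \<epsilon>, optimal_q \<epsilon>})"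
proof -
  \<comment> \<open>With this slope and constant term \<open>- \<epsilon>\<close>, the error
    \<open>saddle - l\<close> is \<open>\<epsilon>\<close> at the origin and
    \<open>- 7 / 9 * \<epsilon>\<close> at the other two vertices.\<close>
  define k where "k = 2 / 3 * sqrt 3 * sqrt \<epsilon>"
  define h :: "real^2 \<Rightarrow> real" where "h x = k * (x $ 1 + x $ 2)" for x
  have "linear h"
    unfolding h_def by (rule linearI) (simp_all add: algebra_simps)
  then have "affine_function (\<lambda>x. h x + - \<epsilon>)"
    unfolding affine_function_def by blast
  moreover have "\<bar>h x + - \<epsilon> - saddle x\<bar> \<le> \<epsilon>" if x: "x \<in> convex hull {0, optimal_p \<epsilon>, optimal_q \<epsilon>}" for x
  proof -
    obtain u v where uv: "0 \<le> u" "0 \<le> v" "u + v \<le> 1" and x: "x = u *\<^sub>R optimal_p \<epsilon> + v *\<^sub>R optimal_q \<epsilon>"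
      using x by (auto simp: convex_hull_3_alt)
    define a where "a = sqrt 3"
    define r where "r = sqrt \<epsilon>"
    have a: "a\<^sup>2 = 3" and r: "r\<^sup>2 = \<epsilon>"
      using eps by (simp_all add: a_def r_def)
    have x12: "x $ 1 = 4 / 3 * r * (u * (a + 1) + v * (a - 1))" "x $ 2 = 4 / 3 * r * (u * (a - 1) + v * (a + 1))"
      unfolding x a_def r_def vector_add_component vector_scaleR_component optimal_nth real_scaleR_def
      by algebra+
    have "9 * saddle x = 16 * \<epsilon> * (2 * (u + v)\<^sup>2 + 4 * u * v)"
    proof -
      have "9 * saddle x = 16 * r\<^sup>2 * ((u * (a + 1) + v * (a - 1)) * (u * (a - 1) + v * (a + 1)))"
        unfolding saddle_def x12 by (simp add: power2_eq_square)
      moreover have "(u * (a + 1) + v * (a - 1)) * (u * (a - 1) + v * (a + 1)) =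
          (a\<^sup>2 - 1) * (u\<^sup>2 + v\<^sup>2) + 2 * (a\<^sup>2 + 1) * (u * v)"
        by algebra
      moreover have "\<dots> = 2 * (u + v)\<^sup>2 + 4 * u * v"
        unfolding a by (simp add: power2_eq_square algebra_simps)
      ultimately show ?thesis by (simp add: r)
    qed
    moreover have "9 * h x = 16 * \<epsilon> * (3 * (u + v))"
    proof -
      have "9 * h x = 16 * a\<^sup>2 * r\<^sup>2 * (u + v)"
        unfolding h_def k_def x12 a_def[symmetric] r_def[symmetric] by algebra
      then show ?thesis unfolding a r by linarith
    qed
    ultimately have eq: "h x + - \<epsilon> - saddle x = \<epsilon> * (16 / 9 * (3 * (u + v) - 2 * (u + v)\<^sup>2 - 4 * (u * v)) - 1)"
      by (simp add: algebra_simps)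
    \<comment> \<open>With \<open>s = u + v\<close>, the claim is that
      \<open>3 * s - 2 * s\<^sup>2 - 4 * u * v\<close> lies between 0 and 9/8. The lower bound uses
      \<open>4 * u * v \<le> s\<^sup>2\<close> and \<open>s \<le> 1\<close>, the upper one
      \<open>u * v \<ge> 0\<close> and the square vanishing at \<open>s = 3 / 4\<close>.\<close>
    have "0 \<le> (u + v) * (1 - (u + v))" "0 \<le> u * v" "0 \<le> (u - v)\<^sup>2" "0 \<le> (4 * (u + v) - 3)\<^sup>2"
      using uv by (auto intro: mult_nonneg_nonneg)
    then have "\<bar>16 / 9 * (3 * (u + v) - 2 * (u + v)\<^sup>2 - 4 * (u * v)) - 1\<bar> \<le> 1"
      unfolding abs_le_iff power2_eq_square by (simp add: algebra_simps)
    then show ?thesis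
      unfolding eq using eps by (simp add: abs_mult mult_left_le)
  qed
  ultimately show ?thesis
    unfolding admits_linear_approximation_def by blast
qed

lemma measure_optimal:
  assumes "0 < \<epsilon>"
  shows "measure lebesgue (convex hull {0, optimal_p \<epsilon>, optimal_q \<epsilon>}) = 32 * sqrt 3 / 9 * \<epsilon>"
  using assms by (simp add: measure_lebesgue_triangle det2_optimal abs_mult)

lemma continuous_on_saddle: "continuous_on S saddle"
  unfolding saddle_def by (intro continuous_intros)

theorem theorem1p1:
  fixes F :: "real^2 \<Rightarrow> real" and \<epsilon> :: real
  assumes F: "\<And>p. F p = p $ 1 * p $ 2"
    and eps: "\<epsilon> > 0"
  shows "optimal_triangle_density F \<epsilon> = ereal (3 * sqrt 3 / (32 * \<epsilon>)) \<and>
         (\<exists>S. optimal_triangle F \<epsilon> S) \<and>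
         (\<forall>S. optimal_triangle F \<epsilon> S \<longrightarrow> measure lebesgue S = 32 * sqrt 3 / 9 * \<epsilon>)"
proof -
  define A where "A = 32 * sqrt 3 / 9 * \<epsilon>"
  have "A > 0" using eps by (simp add: A_def)
  have A: "1 / A = 3 * sqrt 3 / (32 * \<epsilon>)"
    using eps by (simp add: A_def field_simps)
  have F: "F = saddle"
    using F by (simp add: saddle_def fun_eq_iff)
  have det: "det2 (optimal_p \<epsilon>) (optimal_q \<epsilon>) \<noteq> 0" "\<bar>det2 (optimal_p \<epsilon>) (optimal_q \<epsilon>)\<bar> / 2 = A"
    using eps by (simp_all add: det2_optimal A_def abs_mult)
  let ?T = "lattice_triangulation (optimal_p \<epsilon>) (optimal_q \<epsilon>)"
  let ?S = "convex hull {0, optimal_p \<epsilon>, optimal_q \<epsilon>}"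
  have "optimal_triangle_density F \<epsilon> = ereal (1 / A)"
    unfolding optimal_triangle_density_def
  proof (rule antisym)
    have "Inf {triangle_density I T |I T. triangulation I T \<and> (\<exists>g. pwl_approximation I T F \<epsilon> g)}
        \<le> triangle_density lattice_index ?T"
      using triangulation_lattice[OF det(1)] lattice_pwl_approximation[OF det(1) optimal_admits[OF eps]]
      unfolding F by (intro Inf_lower) blast
    also have "\<dots> \<le> ereal (1 / A)"
      using lattice_density_le[OF det(1)] unfolding det(2) .
    finally show "Inf {triangle_density I T |I T. triangulation I T \<and> (\<exists>g. pwl_approximation I T F \<epsilon> g)}
        \<le> ereal (1 / A)" .
    show "ereal (1 / A) \<le> Inf {triangle_density I T |I T. triangulation I T \<and> (\<exists>g. pwl_approximation I T F \<epsilon> g)}"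
    proof (rule Inf_greatest, clarify)
      fix I T g assume tri: "triangulation I T" and g: "pwl_approximation I T F \<epsilon> g"
      show "ereal (1 / A) \<le> triangle_density I T"
      proof (rule triangle_density_ge[OF tri \<open>A > 0\<close>])
        fix i assume "i \<in> I"
        then show "measure lebesgue (T i) \<le> A"
          using measure_triangle_le[OF eps triangulation_triangle[OF tri]]
            pwl_approximation_imp_admits[OF tri continuous_on_saddle] g
          unfolding F A_def by blast
      qed
    qed
  qed
  \<comment> \<open>\<open>?S\<close> attains the area bound, so it is optimal; any other optimal
    triangle must match its area and cannot exceed it.\<close>
  moreover have S: "triangle ?S" "admits_linear_approximation F \<epsilon> ?S" "measure lebesgue ?S = A"
    using triangle_hull[of "optimal_p \<epsilon>" 0 "optimal_q \<epsilon>"] det(1) optimal_admits[OF eps] measure_optimal[OF eps]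
    by (simp_all add: F A_def)
  moreover have le: "measure lebesgue S \<le> A" if "triangle S" "admits_linear_approximation F \<epsilon> S" for S
    using measure_triangle_le[OF eps] that unfolding F A_def by blast
  ultimately show ?thesis
    unfolding optimal_triangle_def A A_def[symmetric] by (metis antisym)
qed

end
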